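(* Assume $P_{D,k}\ge P_{F,k}$ for all $k\in\{1,\dots,K\}$. As the sensors approach a non-line-of-sight (NLOS) condition, i.e. as the Rician factors $\kappa_k\to 0$ for every $k\in\{1,\dots,K\}$ (all other parameters being held fixed), the IS statistic $\Lambda_{\mathrm{IS}}$ and the IGMM statistic $\Lambda_{\mathrm{IGMM}}$ are (in this limit, that is, with their values at $\kappa_1=\dots=\kappa_K=0$) statistically equivalent to the NLOS statistic $\Lambda_{\mathrm{NL}}(\boldsymbol y)=\|\boldsymbol y\|^2$; that is, both rules collapse to an energy detection test.
   Context: Model. Fix integers $K,N\ge1$. For $i\in\{0,1\}$, under hypothesis $\mathcal H_i$ a random vector $\boldsymbol x\in\{0,1\}^K$ has an arbitrary joint pmf $P(\boldsymbol x|\mathcal H_i)$ (no conditional independence assumed), with $P_{1,k}=P_{D,k}=P(x_k=1|\mathcal H_1)$ and $P_{0,k}=P_{F,k}=P(x_k=1|\mathcal H_0)$. Put $\boldsymbol\rho_i=[P_{i,1},\dots,P_{i,K}]^T$ and let $\boldsymbol\Sigma_{\boldsymbol x|\mathcal H_i}$ be the covariance matrix of $\boldsymbol x$ under $\mathcal H_i$. The received vector is $\boldsymbol y=\sum_{k=1}^K\sqrt{\beta_k}\,\big(b_k\,\boldsymbol a(\theta_k)+\sqrt{1-b_k^2}\,\boldsymbol h_k\big)x_k+\boldsymbol w\in\mathbb C^N$, where $\beta_k>0$, $\boldsymbol a(\theta_k)\in\mathbb C^N$ are known vectors, $b_k=\sqrt{\kappa_k/(1+\kappa_k)}$ with Rician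 factor $\kappa_k\ge0$, the $\boldsymbol h_k$ are i.i.d. circular complex Gaussian $\mathcal N_{\mathbb C}(\boldsymbol 0,\boldsymbol I_N)$, $\boldsymbol w\sim\mathcal N_{\mathbb C}(\boldsymbol 0,\sigma_w^2\boldsymbol I_N)$ with $\sigma_w^2>0$, and $\boldsymbol x$, $(\boldsymbol h_k)_k$, $\boldsymbol w$ are independent. Notation. $\boldsymbol\mu_k=\sqrt{\beta_k}\,b_k\,\boldsymbol a(\theta_k)$, $\nu_k=\beta_k(1-b_k^2)$, $\bar{\boldsymbol\mu}=\frac1K\sum_k\boldsymbol\mu_k$, $\bar\nu=\frac1K\sum_k\nu_k$; $\widetilde{\boldsymbol A}=[\boldsymbol\mu_1\cdots\boldsymbol\mu_K]\in\mathbb C^{N\times K}$; $\sigma_{e,i}^2=\sigma_w^2+\sum_k\nu_kP_{i,k}$. For a vector $\boldsymbol v$, the augmented vector $\underline{\boldsymbol v}$ stacks $\boldsymbol v$ on top of its entrywise conjugate $\boldsymbol v^*$; for a matrix $\boldsymbol A$, $\underline{\boldsymbol A}$ stacks $\boldsymbol A$ on top of $\boldsymbol A^*$. $(\cdot)^\dagger$ is conjugate transpose. Statistics. IS (ideal sensors) rule: $\Lambda_{\mathrm{IS}}(\boldsymbol y)=2\,\Re(\bar{\boldsymbol\mu}^\dagger\boldsymbol y)+\frac{\bar\nu}{\sigma_w^2}\|\boldsymbol y\|^2$. NLOS rule: $\Lambda_{\mathrm{NL}}(\boldsymbol y)=\|\boldsymbol y\|^2$. IGMM (improper Gaussian moment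 matching) rule: $\Lambda_{\mathrm{IGMM}}(\boldsymbol y)=-(\underline{\boldsymbol y}-\underline{\widetilde{\boldsymbol A}}\boldsymbol\rho_1)^\dagger\boldsymbol\Sigma_{\underline{\boldsymbol y}|\mathcal H_1}^{-1}(\underline{\boldsymbol y}-\underline{\widetilde{\boldsymbol A}}\boldsymbol\rho_1)+(\underline{\boldsymbol y}-\underline{\widetilde{\boldsymbol A}}\boldsymbol\rho_0)^\dagger\boldsymbol\Sigma_{\underline{\boldsymbol y}|\mathcal H_0}^{-1}(\underline{\boldsymbol y}-\underline{\widetilde{\boldsymbol A}}\boldsymbol\rho_0)$, where $\boldsymbol\Sigma_{\underline{\boldsymbol y}|\mathcal H_i}=\underline{\widetilde{\boldsymbol A}}\,\boldsymbol\Sigma_{\boldsymbol x|\mathcal H_i}\,\underline{\widetilde{\boldsymbol A}}^\dagger+\sigma_{e,i}^2\boldsymbol I_{2N}$. Statistical equivalence. Two real-valued statistics of $\boldsymbol y$ are called statistically equivalent if they agree up to a positive multiplicative constant and an additive constant, neither depending on $\boldsymbol y$ (so threshold tests based on them are the same up to a change of threshold).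
   Formalization: The equivalence of the IGMM statistic with the NLOS statistic is stated only when P_{D,k} > P_{F,k} for at least one k; if P_{D,k} = P_{F,k} for all k, the IGMM statistic at zero Rician factors is identically 0 and the claim fails. *)

theory Defs
  imports "HOL-Analysis.Analysis" "HOL-Probability.Probability_Mass_Function"
begin

definition conj_transpose :: "complex^'m^'n \<Rightarrow> complex^'n^'m" where
  "conj_transpose A = (\<chi> i j. cnj (A $ j $ i))"

text \<open>The scalar \<open>u\<^sup>\<dagger> v\<close>, conjugate-linear in the first argument.\<close>

definition hinner :: "complex^'n \<Rightarrow> complex^'n \<Rightarrow> complex" where
  "hinner u v = (\<Sum>i\<in>UNIV. cnj (u $ i) * v $ i)"

text \<open>Augmented vectors and matrices have rows indexed by the disjoint sum \<open>'n + 'n\<close>: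
  \<open>Inl\<close> is the upper block, \<open>Inr\<close> the conjugated lower block.\<close>

definition aug_vec :: "complex^'n \<Rightarrow> complex^('n + 'n)" where
  "aug_vec v = (\<chi> i. case i of Inl n \<Rightarrow> v $ n | Inr n \<Rightarrow> cnj (v $ n))"

definition aug_mat :: "complex^'k^'n \<Rightarrow> complex^'k^('n + 'n)" where
  "aug_mat A = (\<chi> i k. case i of Inl n \<Rightarrow> A $ n $ k | Inr n \<Rightarrow> cnj (A $ n $ k))"

text \<open>The sensor decision vector under one hypothesis is given by its joint pmf on
  \<open>'k \<Rightarrow> bool\<close>; \<open>x k\<close> stands for \<open>x\<^sub>k = 1\<close>.\<close>

definition prob_vec :: "('k::finite \<Rightarrow> bool) pmf \<Rightarrow> real^'k" where
  "prob_vec P = (\<chi> k. measure_pmf.prob P {x. x k})"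

definition cov_mat :: "('k::finite \<Rightarrow> bool) pmf \<Rightarrow> real^'k^'k" where
  "cov_mat P = (\<chi> j k. measure_pmf.expectation P
     (\<lambda>x. (of_bool (x j) - measure_pmf.expectation P (\<lambda>x. of_bool (x j)))
        * (of_bool (x k) - measure_pmf.expectation P (\<lambda>x. of_bool (x k)))))"

text \<open>Channel parameters: \<open>\<beta> $ k\<close> is the large-scale gain, \<open>a k\<close> the steering vector
  \<open>a(\<theta>\<^sub>k)\<close>, \<open>\<kappa> $ k\<close> the Rician factor of sensor \<open>k\<close>, and \<open>s\<close> the noise variance
  \<open>\<sigma>\<^sub>w\<^sup>2\<close> (not its square root).\<close>

definition rice_b :: "real^'k \<Rightarrow> 'k \<Rightarrow> real" where
  "rice_b \<kappa> k = sqrt (\<kappa> $ k / (1 + \<kappa> $ k))"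

definition los_mean :: "real^'k \<Rightarrow> ('k \<Rightarrow> complex^'n) \<Rightarrow> real^'k \<Rightarrow> 'k \<Rightarrow> complex^'n" where
  "los_mean \<beta> a \<kappa> k = (sqrt (\<beta> $ k) * rice_b \<kappa> k) *\<^sub>R a k"

definition nlos_var :: "real^'k \<Rightarrow> real^'k \<Rightarrow> 'k \<Rightarrow> real" where
  "nlos_var \<beta> \<kappa> k = \<beta> $ k * (1 - (rice_b \<kappa> k)\<^sup>2)"

definition mean_los :: "real^'k \<Rightarrow> ('k \<Rightarrow> complex^'n) \<Rightarrow> real^'k \<Rightarrow> complex^'n" where
  "mean_los \<beta> a \<kappa> = (1 / real CARD('k)) *\<^sub>R (\<Sum>k\<in>UNIV. los_mean \<beta> a \<kappa> k)"

definition mean_nlos_var :: "real^'k \<Rightarrow> real^'k \<Rightarrow> real" where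
  "mean_nlos_var \<beta> \<kappa> = (1 / real CARD('k)) * (\<Sum>k\<in>UNIV. nlos_var \<beta> \<kappa> k)"

definition los_mat :: "real^'k \<Rightarrow> ('k \<Rightarrow> complex^'n) \<Rightarrow> real^'k \<Rightarrow> complex^'k^'n" where
  "los_mat \<beta> a \<kappa> = (\<chi> n k. los_mean \<beta> a \<kappa> k $ n)"

definition eff_noise_var :: "real^'k \<Rightarrow> real^'k \<Rightarrow> real \<Rightarrow> ('k::finite \<Rightarrow> bool) pmf \<Rightarrow> real" where
  "eff_noise_var \<beta> \<kappa> s P = s + (\<Sum>k\<in>UNIV. nlos_var \<beta> \<kappa> k * prob_vec P $ k)"

definition aug_cov ::
  "real^'k \<Rightarrow> ('k::finite \<Rightarrow> complex^'n) \<Rightarrow> real^'k \<Rightarrow> real \<Rightarrow> ('k \<Rightarrow> bool) pmf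
     \<Rightarrow> complex^('n + 'n)^('n + 'n)" where
  "aug_cov \<beta> a \<kappa> s P =
     aug_mat (los_mat \<beta> a \<kappa>) ** map_matrix complex_of_real (cov_mat P)
       ** conj_transpose (aug_mat (los_mat \<beta> a \<kappa>))
     + mat (complex_of_real (eff_noise_var \<beta> \<kappa> s P))"

definition stat_IS ::
  "real^'k \<Rightarrow> ('k::finite \<Rightarrow> complex^'n) \<Rightarrow> real^'k \<Rightarrow> real \<Rightarrow> complex^'n \<Rightarrow> real" where
  "stat_IS \<beta> a \<kappa> s y =
     2 * Re (hinner (mean_los \<beta> a \<kappa>) y) + mean_nlos_var \<beta> \<kappa> / s * (norm y)\<^sup>2"

definition stat_NL :: "complex^'n \<Rightarrow> real" where
  "stat_NL y = (norm y)\<^sup>2"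

definition aug_residual ::
  "real^'k \<Rightarrow> ('k::finite \<Rightarrow> complex^'n) \<Rightarrow> real^'k \<Rightarrow> ('k \<Rightarrow> bool) pmf
     \<Rightarrow> complex^'n \<Rightarrow> complex^('n + 'n)" where
  "aug_residual \<beta> a \<kappa> P y =
     aug_vec y - aug_mat (los_mat \<beta> a \<kappa>) *v (\<chi> k. complex_of_real (prob_vec P $ k))"

definition aug_quad ::
  "real^'k \<Rightarrow> ('k::finite \<Rightarrow> complex^'n) \<Rightarrow> real^'k \<Rightarrow> real \<Rightarrow> ('k \<Rightarrow> bool) pmf
     \<Rightarrow> complex^'n \<Rightarrow> complex" where
  "aug_quad \<beta> a \<kappa> s P y =
     hinner (aug_residual \<beta> a \<kappa> P y)
       (matrix_inv (aug_cov \<beta> a \<kappa> s P) *v aug_residual \<beta> a \<kappa> P y)"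

text \<open>\<open>P0\<close> and \<open>P1\<close> are the joint pmfs under the two hypotheses.  For \<open>s > 0\<close>, \<open>\<beta> > 0\<close>,
  \<open>\<kappa> \<ge> 0\<close> the augmented covariances are Hermitian positive definite, so \<open>matrix_inv\<close> is a
  genuine inverse and both quadratic forms are real; \<open>Re\<close> only changes the type.\<close>

definition stat_IGMM ::
  "real^'k \<Rightarrow> ('k::finite \<Rightarrow> complex^'n) \<Rightarrow> real^'k \<Rightarrow> real
     \<Rightarrow> ('k \<Rightarrow> bool) pmf \<Rightarrow> ('k \<Rightarrow> bool) pmf \<Rightarrow> complex^'n \<Rightarrow> real" where
  "stat_IGMM \<beta> a \<kappa> s P0 P1 y = Re (- aug_quad \<beta> a \<kappa> s P1 y + aug_quad \<beta> a \<kappa> s P0 y)"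

definition stat_equiv :: "('y \<Rightarrow> real) \<Rightarrow> ('y \<Rightarrow> real) \<Rightarrow> bool" where
  "stat_equiv S T \<longleftrightarrow> (\<exists>c d. c > 0 \<and> (\<forall>y. S y = c * T y + d))"

end

theory Submission
  imports Defs
begin

text \<open>At \<open>\<kappa> = 0\<close> all line-of-sight means vanish, so the augmented covariance under each
  hypothesis is the scalar matrix \<open>\<sigma>\<^sub>e\<^sup>2 I\<close> and the IGMM statistic becomes
  \<open>2 (1 / \<sigma>\<^sub>e\<^sub>,\<^sub>0\<^sup>2 - 1 / \<sigma>\<^sub>e\<^sub>,\<^sub>1\<^sup>2) \<parallel>y\<parallel>\<^sup>2\<close>; the factor is positive exactly because some
  \<open>P\<^sub>D\<^sub>,\<^sub>k\<close> exceeds \<open>P\<^sub>F\<^sub>,\<^sub>k\<close>.  For the limit, Cramer's rule expresses the solution of a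
  linear system by determinants, which shows that it depends continuously on the matrix and
  the right-hand side wherever the matrix is invertible.\<close>

section \<open>Continuity of matrix operations and of solutions of linear systems\<close>

lemma tendsto_det:
  fixes A :: "'a \<Rightarrow> complex^'m^'m"
  assumes "(A \<longlongrightarrow> L) F"
  shows "((\<lambda>x. det (A x)) \<longlongrightarrow> det L) F"
  unfolding det_def by (intro tendsto_intros assms)

lemma matrix_mult_matrix_inv:
  assumes "invertible A"
  shows "A ** matrix_inv A = mat 1"
  using someI_ex[OF assms[unfolded invertible_def]] by (simp add: matrix_inv_def)

text \<open>\<open>matrix_inv\<close> is defined by choice, which hides its dependence on the
  entries. Cramer's rule replaces it by a quotient of polynomials in the entries of \<open>A\<close>
  and \<open>b\<close>.\<close>

lemma matrix_inv_mult_vec_cramer: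
  fixes A :: "complex^'m^'m"
  assumes "det A \<noteq> 0"
  shows "matrix_inv A *v b =
    (\<chi> k. det (\<chi> i j. if j = k then b $ i else A $ i $ j) / det A)"
proof -
  have "A ** matrix_inv A = mat 1"
    using assms by (simp add: invertible_det_nz matrix_mult_matrix_inv)
  then have "A *v (matrix_inv A *v b) = b"
    by (simp add: matrix_vector_mul_assoc)
  then show ?thesis
    using cramer[OF assms] by blast
qed

lemma tendsto_matrix_inv_mult_vec:
  fixes A :: "'a \<Rightarrow> complex^'m^'m"
  assumes A: "(A \<longlongrightarrow> L) F" and b: "(b \<longlongrightarrow> l) F" and L: "det L \<noteq> 0"
  shows "((\<lambda>x. matrix_inv (A x) *v b x) \<longlongrightarrow> matrix_inv L *v l) F"
proof -
  have "((\<lambda>x. if j = k then b x $ i else A x $ i $ j)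
      \<longlongrightarrow> (if j = k then l $ i else L $ i $ j)) F" for i j k
    by (auto intro!: tendsto_intros A b)
  then have "((\<lambda>x. (\<chi> k. det (\<chi> i j. if j = k then b x $ i else A x $ i $ j) / det (A x)))
      \<longlongrightarrow> matrix_inv L *v l) F"
    unfolding matrix_inv_mult_vec_cramer[OF L]
    by (intro tendsto_intros tendsto_det A L)
  \<comment> \<open>The Cramer quotient represents \<open>matrix_inv (A x) *v b x\<close> only where
    \<open>A x\<close> is invertible. Since \<open>det L \<noteq> 0\<close> and the determinant is
    continuous, this holds eventually along \<open>F\<close>.\<close>
  moreover have "\<forall>\<^sub>F x in F. det (A x) \<noteq> 0"
    using tendsto_imp_eventually_ne[OF tendsto_det[OF A] L] .
  then have "\<forall>\<^sub>F x in F. (\<chi> k. det (\<chi> i j. if j = k then b x $ i else A x $ i $ j) / det (A x))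
      = matrix_inv (A x) *v b x"
    by eventually_elim (simp add: matrix_inv_mult_vec_cramer)
  ultimately show ?thesis
    by (rule Lim_transform_eventually)
qed

lemma tendsto_matrix_mult:
  fixes A :: "'a \<Rightarrow> complex^'m^'n" and B :: "'a \<Rightarrow> complex^'p^'m"
  assumes "(A \<longlongrightarrow> L) F" and "(B \<longlongrightarrow> M) F"
  shows "((\<lambda>x. A x ** B x) \<longlongrightarrow> L ** M) F"
  unfolding matrix_matrix_mult_def by (intro tendsto_intros assms)

lemma tendsto_matrix_vector_mult:
  fixes A :: "'a \<Rightarrow> complex^'m^'n"
  assumes "(A \<longlongrightarrow> L) F" and "(v \<longlongrightarrow> l) F"
  shows "((\<lambda>x. A x *v v x) \<longlongrightarrow> L *v l) F"
  unfolding matrix_vector_mult_def by (intro tendsto_intros assms)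

lemma tendsto_conj_transpose:
  assumes "(A \<longlongrightarrow> L) F"
  shows "((\<lambda>x. conj_transpose (A x)) \<longlongrightarrow> conj_transpose L) F"
  unfolding conj_transpose_def by (intro tendsto_intros assms)

lemma tendsto_aug_mat:
  assumes "(A \<longlongrightarrow> L) F"
  shows "((\<lambda>x. aug_mat (A x)) \<longlongrightarrow> aug_mat L) F"
  unfolding aug_mat_def
  by (intro tendsto_vec_lambda) (auto intro!: tendsto_intros assms split: sum.split)

lemma tendsto_hinner:
  assumes "(u \<longlongrightarrow> l) F" and "(v \<longlongrightarrow> m) F"
  shows "((\<lambda>x. hinner (u x) (v x)) \<longlongrightarrow> hinner l m) F"
  unfolding hinner_def by (intro tendsto_intros assms)

lemma tendsto_mat:
  fixes c :: "'a \<Rightarrow> complex"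
  assumes "(c \<longlongrightarrow> l) F"
  shows "((\<lambda>x. mat (c x) :: complex^'m^'m) \<longlongrightarrow> mat l) F"
  unfolding mat_def
  by (intro tendsto_vec_lambda) (auto intro!: tendsto_intros assms)

section \<open>Scalar matrices and augmented quadratic forms\<close>

lemma mat_mult_vec: "mat (c :: complex) *v v = c *s v"
  by (simp add: vec_eq_iff matrix_vector_mult_def mat_def if_distrib if_distribR cong: if_cong)

lemma matrix_inv_mat:
  fixes c :: complex
  assumes "c \<noteq> 0"
  shows "matrix_inv (mat c :: complex^'m^'m) = mat (1 / c)"
proof -
  have inv: "mat c ** mat (1 / c) = (mat 1 :: complex^'m^'m)"
    "mat (1 / c) ** mat c = (mat 1 :: complex^'m^'m)"
    using assms by (simp_all add: matrix_eq mat_mult_vec flip: matrix_vector_mul_assoc)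
  then have "invertible (mat c :: complex^'m^'m)"
    unfolding invertible_def by blast
  then have "mat c ** matrix_inv (mat c) = (mat 1 :: complex^'m^'m)"
    by (rule matrix_mult_matrix_inv)
  \<comment> \<open>Uniqueness of inverses: multiplying
    \<open>mat c ** matrix_inv (mat c) = mat 1\<close> on the left by \<open>mat (1 / c)\<close>
    cancels \<open>mat c\<close>.\<close>
  then show ?thesis
    using inv by (metis matrix_mul_assoc matrix_mul_lid matrix_mul_rid)
qed

text \<open>The factor 2 arises because the upper block and the conjugated lower block each
  contribute the energy of \<open>y\<close>.\<close>

lemma hinner_aug_vec_scaled:
  "hinner (aug_vec y) (c *s aug_vec y) = 2 * c * complex_of_real ((norm y)\<^sup>2)"
proof -
  have norm: "complex_of_real ((norm y)\<^sup>2) = (\<Sum>i\<in>UNIV. cnj (y $ i) * y $ i)"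
    by (simp add: norm_vec_def L2_set_def sum_nonneg complex_norm_square mult.commute
        flip: of_real_power)
  have "hinner (aug_vec y) (c *s aug_vec y)
      = c * (\<Sum>i\<in>UNIV. cnj (y $ i) * y $ i) + c * (\<Sum>i\<in>UNIV. y $ i * cnj (y $ i))"
    by (simp add: hinner_def aug_vec_def sum.Plus sum_distrib_left algebra_simps
        flip: UNIV_Plus_UNIV)
  then show ?thesis
    unfolding norm by (simp add: mult.commute)
qed

section \<open>Values at zero Rician factors\<close>

lemma rice_b_zero [simp]: "rice_b 0 k = 0"
  by (simp add: rice_b_def)

lemma los_mean_zero [simp]: "los_mean \<beta> a 0 k = 0"
  by (simp add: los_mean_def)

lemma nlos_var_zero [simp]: "nlos_var \<beta> 0 k = \<beta> $ k"
  by (simp add: nlos_var_def)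

lemma los_mat_zero [simp]: "los_mat \<beta> a 0 = 0"
  by (simp add: los_mat_def vec_eq_iff)

lemma aug_mat_zero [simp]: "aug_mat 0 = 0"
  by (simp add: aug_mat_def vec_eq_iff split: sum.split)

lemma eff_noise_var_zero:
  "eff_noise_var \<beta> 0 s P = s + (\<Sum>k\<in>UNIV. \<beta> $ k * prob_vec P $ k)"
  by (simp add: eff_noise_var_def)

lemma eff_noise_var_zero_pos:
  assumes "\<forall>k. \<beta> $ k > 0" and "s > 0"
  shows "eff_noise_var \<beta> 0 s P > 0"
  unfolding eff_noise_var_zero
  using assms by (auto intro!: add_pos_nonneg sum_nonneg mult_nonneg_nonneg
      simp: prob_vec_def less_imp_le)

lemma aug_cov_zero: "aug_cov \<beta> a 0 s P = mat (complex_of_real (eff_noise_var \<beta> 0 s P))"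
  by (simp add: aug_cov_def)

text \<open>With \<open>los_mat\<close> zero, the residual is \<open>aug_vec y\<close> itself, so
  \<open>P\<close> enters only through the effective noise variance.\<close>

lemma aug_quad_zero:
  assumes "eff_noise_var \<beta> 0 s P \<noteq> 0"
  shows "aug_quad \<beta> a 0 s P y = complex_of_real (2 * (norm y)\<^sup>2 / eff_noise_var \<beta> 0 s P)"
  using assms
  by (simp add: aug_quad_def aug_residual_def aug_cov_zero matrix_inv_mat mat_mult_vec
      hinner_aug_vec_scaled)

section \<open>Limits as the Rician factors tend to zero\<close>

lemma tendsto_rice_b: "((\<lambda>\<kappa>. rice_b \<kappa> k) \<longlongrightarrow> rice_b 0 k) (at 0 within S)"
  \<comment> \<open>The real \<open>sqrt\<close> is continuous everywhere, so any \<open>S\<close>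
    is admissible. The remaining goal is that the denominator has a nonzero limit, namely 1.\<close>
  unfolding rice_b_def by (intro tendsto_intros) simp

lemma tendsto_los_mean: "((\<lambda>\<kappa>. los_mean \<beta> a \<kappa> k) \<longlongrightarrow> los_mean \<beta> a 0 k) (at 0 within S)"
  unfolding los_mean_def by (intro tendsto_intros tendsto_rice_b)

lemma tendsto_nlos_var: "((\<lambda>\<kappa>. nlos_var \<beta> \<kappa> k) \<longlongrightarrow> nlos_var \<beta> 0 k) (at 0 within S)"
  unfolding nlos_var_def by (intro tendsto_intros tendsto_rice_b)

lemma tendsto_los_mat: "((\<lambda>\<kappa>. los_mat \<beta> a \<kappa>) \<longlongrightarrow> los_mat \<beta> a 0) (at 0 within S)"
  unfolding los_mat_def by (intro tendsto_intros tendsto_los_mean)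

lemma tendsto_eff_noise_var:
  "((\<lambda>\<kappa>. eff_noise_var \<beta> \<kappa> s P) \<longlongrightarrow> eff_noise_var \<beta> 0 s P) (at 0 within S)"
  unfolding eff_noise_var_def by (intro tendsto_intros tendsto_nlos_var)

lemma tendsto_aug_cov:
  "((\<lambda>\<kappa>. aug_cov \<beta> a \<kappa> s P) \<longlongrightarrow> aug_cov \<beta> a 0 s P) (at 0 within S)"
  unfolding aug_cov_def
  by (intro tendsto_add tendsto_matrix_mult tendsto_conj_transpose tendsto_aug_mat
      tendsto_los_mat tendsto_mat tendsto_of_real tendsto_eff_noise_var tendsto_const)

lemma tendsto_aug_residual:
  "((\<lambda>\<kappa>. aug_residual \<beta> a \<kappa> P y) \<longlongrightarrow> aug_residual \<beta> a 0 P y) (at 0 within S)"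
  unfolding aug_residual_def
  by (intro tendsto_diff tendsto_matrix_vector_mult tendsto_aug_mat tendsto_los_mat tendsto_const)

lemma tendsto_aug_quad:
  assumes "eff_noise_var \<beta> 0 s P \<noteq> 0"
  shows "((\<lambda>\<kappa>. aug_quad \<beta> a \<kappa> s P y) \<longlongrightarrow> aug_quad \<beta> a 0 s P y) (at 0 within S)"
proof -
  have "det (aug_cov \<beta> a 0 s P) \<noteq> 0"
    \<comment> \<open>The limiting covariance is diagonal, so its determinant is a power of the
      effective noise variance.\<close>
    using assms by (simp add: aug_cov_zero det_diagonal mat_def)
  then show ?thesis
    unfolding aug_quad_def
    by (intro tendsto_hinner tendsto_matrix_inv_mult_vec tendsto_aug_residual tendsto_aug_cov)
qed

lemma tendsto_stat_IS:
  "((\<lambda>\<kappa>. stat_IS \<beta> a \<kappa> s y) \<longlongrightarrow> stat_IS \<beta> a 0 s y) (at 0 within S)"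
  \<comment> \<open>Division by \<open>s\<close> becomes multiplication by the constant
    \<open>inverse s\<close>, which the product and constant rules handle.\<close>
  unfolding stat_IS_def mean_los_def mean_nlos_var_def divide_inverse
  by (intro tendsto_add tendsto_mult tendsto_Re tendsto_hinner tendsto_scaleR tendsto_sum
      tendsto_los_mean tendsto_nlos_var tendsto_const)

lemma tendsto_stat_IGMM:
  assumes "eff_noise_var \<beta> 0 s P0 \<noteq> 0" and "eff_noise_var \<beta> 0 s P1 \<noteq> 0"
  shows "((\<lambda>\<kappa>. stat_IGMM \<beta> a \<kappa> s P0 P1 y) \<longlongrightarrow> stat_IGMM \<beta> a 0 s P0 P1 y) (at 0 within S)"
  unfolding stat_IGMM_def by (intro tendsto_intros tendsto_aug_quad assms)

section \<open>Equivalence with the energy detector\<close>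

lemma stat_equiv_IS_zero:
  fixes \<beta> :: "real^'k" and a :: "'k \<Rightarrow> complex^'n"
  assumes "\<forall>k. \<beta> $ k > 0" and "s > 0"
  shows "stat_equiv (stat_IS \<beta> a 0 s) stat_NL"
  unfolding stat_equiv_def
proof (intro exI conjI allI)
  show "mean_nlos_var \<beta> 0 / s > 0"
    using assms by (simp add: mean_nlos_var_def sum_pos)
  show "stat_IS \<beta> a 0 s y = mean_nlos_var \<beta> 0 / s * stat_NL y + 0" for y
    by (simp add: stat_IS_def stat_NL_def mean_los_def hinner_def)
qed

text \<open>A larger variance under \<open>P1\<close> makes the negatively signed form the smaller
  one, leaving a positive multiple of the energy. With equal variances the two forms would cancel
  and the statistic would be identically 0.\<close>

lemma stat_equiv_IGMM_zero:
  assumes "0 < eff_noise_var \<beta> 0 s P0" and "eff_noise_var \<beta> 0 s P0 < eff_noise_var \<beta> 0 s P1"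
  shows "stat_equiv (stat_IGMM \<beta> a 0 s P0 P1) stat_NL"
  unfolding stat_equiv_def
proof (intro exI conjI allI)
  let ?c = "2 * (1 / eff_noise_var \<beta> 0 s P0 - 1 / eff_noise_var \<beta> 0 s P1)"
  show "?c > 0"
    using assms by (simp add: frac_less2)
  show "stat_IGMM \<beta> a 0 s P0 P1 y = ?c * stat_NL y + 0" for y
    using assms by (simp add: stat_IGMM_def stat_NL_def aug_quad_zero algebra_simps)
qed

theorem lemma1:
  fixes \<beta> :: "real^'k" and a :: "'k \<Rightarrow> complex^'n" and \<sigma>w2 :: real
    and P0 P1 :: "('k \<Rightarrow> bool) pmf"
  assumes "\<forall>k. \<beta> $ k > 0" and "\<sigma>w2 > 0"
    and "\<forall>k. prob_vec P1 $ k \<ge> prob_vec P0 $ k"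
  shows "(\<forall>y. ((\<lambda>\<kappa>. stat_IS \<beta> a \<kappa> \<sigma>w2 y) \<longlongrightarrow> stat_IS \<beta> a 0 \<sigma>w2 y)
            (at 0 within {\<kappa>. \<forall>k. \<kappa> $ k \<ge> 0}))
     \<and> (\<forall>y. ((\<lambda>\<kappa>. stat_IGMM \<beta> a \<kappa> \<sigma>w2 P0 P1 y) \<longlongrightarrow> stat_IGMM \<beta> a 0 \<sigma>w2 P0 P1 y)
            (at 0 within {\<kappa>. \<forall>k. \<kappa> $ k \<ge> 0}))
     \<and> stat_equiv (stat_IS \<beta> a 0 \<sigma>w2) stat_NL
     \<and> ((\<exists>k. prob_vec P1 $ k > prob_vec P0 $ k)
          \<longrightarrow> stat_equiv (stat_IGMM \<beta> a 0 \<sigma>w2 P0 P1) stat_NL)"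
proof (intro conjI allI impI)
  note pos = eff_noise_var_zero_pos[OF assms(1,2)]
  show "((\<lambda>\<kappa>. stat_IGMM \<beta> a \<kappa> \<sigma>w2 P0 P1 y) \<longlongrightarrow> stat_IGMM \<beta> a 0 \<sigma>w2 P0 P1 y)
      (at 0 within {\<kappa>. \<forall>k. \<kappa> $ k \<ge> 0})" for y
    by (intro tendsto_stat_IGMM pos[THEN less_imp_neq, symmetric])
  assume "\<exists>k. prob_vec P1 $ k > prob_vec P0 $ k"
  \<comment> \<open>Every summand is weakly ordered, and at the sensor with strict inequality the
    positive gain keeps it strict. Adding the common noise variance then orders the effective
    variances.\<close>
  then have "(\<Sum>k\<in>UNIV. \<beta> $ k * prob_vec P0 $ k) < (\<Sum>k\<in>UNIV. \<beta> $ k * prob_vec P1 $ k)"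
    using assms by (intro sum_strict_mono_ex1) (auto intro: mult_left_mono simp: less_imp_le)
  then show "stat_equiv (stat_IGMM \<beta> a 0 \<sigma>w2 P0 P1) stat_NL"
    by (intro stat_equiv_IGMM_zero pos) (simp add: eff_noise_var_zero)
qed (use assms in \<open>simp_all add: tendsto_stat_IS stat_equiv_IS_zero\<close>)

end
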